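(* Suppose ribbon skew shapes $\lambda/\mu$ and $\rho/\eta$ correspond to compositions $\beta$ and $\gamma$, where $\beta\sim\gamma$ are both compositions of $n$. Then, for all partitions $\nu$ of $n$, $$c^{\lambda}_{\mu,\nu}=c^{\rho}_{\eta,\nu}.$$
   Context: $c^\lambda_{\mu,\nu}$ are the Littlewood–Richardson coefficients: $s_{\lambda/\mu}=\sum_\nu c^\lambda_{\mu,\nu}s_\nu$. A ribbon is a connected skew diagram containing no $2\times2$ array of boxes; it corresponds to the composition $\beta$ for which $\beta_i$ is the number of boxes in its $i$-th (nonempty) row from the bottom. A composition $\beta$ of $n$ is a finite list $\beta_1\cdots\beta_k$ of positive integers with sum $n$. $M_\beta=\sum_{i_1<\cdots<i_k}x_{i_1}^{\beta_1}\cdots x_{i_k}^{\beta_k}$ and $F_\beta=\sum_{\gamma\le\beta}M_\gamma$, sum over all refinements $\gamma$ of $\beta$ (compositions from which $\beta$ is obtained by adding together adjacent components). The $F_\beta$ (with $F_0=1$) form a basis of the quasisymmetric functions over $\mathbb{Q}$, which contain the algebra $\Lambda$ of symmetric functions. $\beta\sim\gamma$ means that for all $F=\sum_\alpha c_\alpha F_\alpha\in\Lambda$ one has $c_\beta=c_\gamma$. *)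

theory Defs
  imports Complex_Main "HOL-Library.Multiset" "HOL-Library.FuncSet"
begin

text \<open>
  A monomial in the variables \<open>x\<^sub>0, x\<^sub>1, \<dots>\<close> is the multiset of (indices of) its variables:
  \<open>count m i\<close> is the exponent of \<open>x\<^sub>i\<close> in \<open>m\<close>. A formal power series is its coefficient function,
  so vector space operations are pointwise.
\<close>

type_synonym monomial = "nat multiset"
type_synonym series = "monomial \<Rightarrow> rat"

definition linear_comb :: "('a \<Rightarrow> rat) \<Rightarrow> ('a \<Rightarrow> series) \<Rightarrow> series" where
  "linear_comb c f = (\<lambda>m. \<Sum>a | c a \<noteq> 0. c a * f a m)"

text \<open>
  Symmetric functions have bounded degree. As a monomial involves finitely many variables only,
  invariance under all bijections of the variables is the same as under finitary ones.
\<close>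

definition symmetric_functions :: "series set" where
  "symmetric_functions =
     {f. (\<exists>d. \<forall>m. f m \<noteq> 0 \<longrightarrow> size m \<le> d) \<and>
         (\<forall>\<pi> m. bij \<pi> \<longrightarrow> f (image_mset \<pi> m) = f m)}"


section \<open>Compositions and quasisymmetric functions\<close>

definition composition :: "nat list \<Rightarrow> bool" where
  "composition \<beta> \<longleftrightarrow> 0 \<notin> set \<beta>"

definition composition_of :: "nat \<Rightarrow> nat list \<Rightarrow> bool" where
  "composition_of n \<beta> \<longleftrightarrow> composition \<beta> \<and> sum_list \<beta> = n"

definition refines :: "nat list \<Rightarrow> nat list \<Rightarrow> bool" where
  "refines \<gamma> \<beta> \<longleftrightarrow> composition \<gamma> \<and>
     (\<exists>blocks. [] \<notin> set blocks \<and> concat blocks = \<gamma> \<and> map sum_list blocks = \<beta>)"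

text \<open>
  The coefficient of \<open>m\<close> in \<open>M\<^sub>\<beta>\<close> counts the sequences \<open>i\<^sub>1 < \<dots> < i\<^sub>k\<close>
  with \<open>x\<^bsub>i\<^sub>1\<^esub>\<^bsup>\<beta>\<^sub>1\<^esup> \<dots> x\<^bsub>i\<^sub>k\<^esub>\<^bsup>\<beta>\<^sub>k\<^esup> = m\<close>.
\<close>

definition monomial_qsym :: "nat list \<Rightarrow> series" where
  "monomial_qsym \<beta> = (\<lambda>m. of_nat (card {is. length is = length \<beta> \<and> sorted_wrt (<) is \<and>
     (\<Sum>j<length \<beta>. replicate_mset (\<beta> ! j) (is ! j)) = m}))"

definition fundamental_qsym :: "nat list \<Rightarrow> series" where
  "fundamental_qsym \<beta> = (\<lambda>m. \<Sum>\<gamma> | refines \<gamma> \<beta>. monomial_qsym \<gamma> m)"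

definition comp_equiv :: "nat list \<Rightarrow> nat list \<Rightarrow> bool" where
  "comp_equiv \<beta> \<gamma> \<longleftrightarrow>
     (\<forall>c. finite {\<alpha>. c \<alpha> \<noteq> 0} \<longrightarrow> (\<forall>\<alpha>. c \<alpha> \<noteq> 0 \<longrightarrow> composition \<alpha>) \<longrightarrow>
          linear_comb c fundamental_qsym \<in> symmetric_functions \<longrightarrow> c \<beta> = c \<gamma>)"


section \<open>Partitions and skew diagrams\<close>

definition is_partition :: "nat list \<Rightarrow> bool" where
  "is_partition \<nu> \<longleftrightarrow> sorted_wrt (\<ge>) \<nu> \<and> 0 \<notin> set \<nu>"

definition partition_of :: "nat \<Rightarrow> nat list \<Rightarrow> bool" where
  "partition_of n \<nu> \<longleftrightarrow> is_partition \<nu> \<and> sum_list \<nu> = n"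

text \<open>Boxes are pairs (row, column), both counted from 0, with row 0 at the top.\<close>

definition diagram :: "nat list \<Rightarrow> (nat \<times> nat) set" where
  "diagram \<nu> = {(i, j). i < length \<nu> \<and> j < \<nu> ! i}"

definition skew_diagram :: "nat list \<Rightarrow> nat list \<Rightarrow> (nat \<times> nat) set" where
  "skew_diagram lam \<mu> = diagram lam - diagram \<mu>"

definition skew_shape :: "nat list \<Rightarrow> nat list \<Rightarrow> bool" where
  "skew_shape lam \<mu> \<longleftrightarrow> is_partition lam \<and> is_partition \<mu> \<and> diagram \<mu> \<subseteq> diagram lam"

fun adjacent :: "nat \<times> nat \<Rightarrow> nat \<times> nat \<Rightarrow> bool" where
  "adjacent (i, j) (i', j') \<longleftrightarrow>
     i = i' \<and> (j' = Suc j \<or> j = Suc j') \<or> j = j' \<and> (i' = Suc i \<or> i = Suc i')"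

definition connected_diagram :: "(nat \<times> nat) set \<Rightarrow> bool" where
  "connected_diagram D \<longleftrightarrow>
     (\<forall>p\<in>D. \<forall>q\<in>D. (p, q) \<in> {(a, b). a \<in> D \<and> b \<in> D \<and> adjacent a b}\<^sup>*)"

definition ribbon :: "nat list \<Rightarrow> nat list \<Rightarrow> bool" where
  "ribbon lam \<mu> \<longleftrightarrow> skew_shape lam \<mu> \<and> connected_diagram (skew_diagram lam \<mu>) \<and>
     \<not> (\<exists>i j. {(i, j), (i, Suc j), (Suc i, j), (Suc i, Suc j)} \<subseteq> skew_diagram lam \<mu>)"

text \<open>The numbers of boxes in the nonempty rows, listed from the bottom row to the top row.\<close>

definition row_composition :: "nat list \<Rightarrow> nat list \<Rightarrow> nat list" where
  "row_composition lam \<mu> =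
     rev (filter (\<lambda>k. k \<noteq> 0) (map (\<lambda>i. card {j. (i, j) \<in> skew_diagram lam \<mu>}) [0..<length lam]))"


section \<open>Schur functions and Littlewood--Richardson coefficients\<close>

text \<open>
  A filling is a function on all pairs; extensionality pins down its values outside the diagram,
  so that fillings of the diagram are counted correctly.
\<close>

definition semistandard_tableaux :: "(nat \<times> nat) set \<Rightarrow> (nat \<times> nat \<Rightarrow> nat) set" where
  "semistandard_tableaux D = {T \<in> extensional D.
     (\<forall>i j j'. (i, j) \<in> D \<longrightarrow> (i, j') \<in> D \<longrightarrow> j < j' \<longrightarrow> T (i, j) \<le> T (i, j')) \<and>
     (\<forall>i i' j. (i, j) \<in> D \<longrightarrow> (i', j) \<in> D \<longrightarrow> i < i' \<longrightarrow> T (i, j) < T (i', j))}"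

definition skew_schur :: "nat list \<Rightarrow> nat list \<Rightarrow> series" where
  "skew_schur lam \<mu> = (\<lambda>m. of_nat (card {T \<in> semistandard_tableaux (skew_diagram lam \<mu>).
     image_mset T (mset_set (skew_diagram lam \<mu>)) = m}))"

abbreviation schur :: "nat list \<Rightarrow> series" where
  "schur \<nu> \<equiv> skew_schur \<nu> []"

text \<open>
  The Schur functions are a basis of the symmetric functions, which contain all skew Schur
  functions; requiring \<open>c\<close> to vanish off partitions makes it unique as a function on all lists.
\<close>

definition littlewood_richardson :: "nat list \<Rightarrow> nat list \<Rightarrow> nat list \<Rightarrow> rat" where
  "littlewood_richardson lam \<mu> =
     (THE c. finite {\<nu>. c \<nu> \<noteq> 0} \<and> (\<forall>\<nu>. c \<nu> \<noteq> 0 \<longrightarrow> is_partition \<nu>) \<and>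
             skew_schur lam \<mu> = linear_comb c schur)"


section \<open>The index sets of the above sums and cardinalities are finite\<close>

lemma length_le_sum_list_composition: "composition \<beta> \<Longrightarrow> length \<beta> \<le> sum_list \<beta>"
  by (induction \<beta>) (auto simp: composition_def)

lemma finite_refinements: "finite {\<gamma>. refines \<gamma> \<beta>}"
proof (rule finite_subset)
  show "{\<gamma>. refines \<gamma> \<beta>} \<subseteq> {\<gamma>. set \<gamma> \<subseteq> {..sum_list \<beta>} \<and> length \<gamma> \<le> sum_list \<beta>}"
  proof safe
    fix \<gamma> x assume r: "refines \<gamma> \<beta>"
    have "sum_list (concat bs) = sum_list (map sum_list bs)" for bs :: "nat list list"
      by (induction bs) auto
    then have s: "sum_list \<gamma> = sum_list \<beta>" and c: "composition \<gamma>"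
      using r by (auto simp: refines_def)
    show "length \<gamma> \<le> sum_list \<beta>" using length_le_sum_list_composition[OF c] s by simp
    assume "x \<in> set \<gamma>" then show "x \<le> sum_list \<beta>" using s member_le_sum_list[of x \<gamma>] by simp
  qed
qed (rule finite_lists_length_le, simp)

lemma finite_monomial_qsym_indices:
  assumes "composition \<beta>"
  shows "finite {is. length is = length \<beta> \<and> sorted_wrt (<) is \<and>
     (\<Sum>j<length \<beta>. replicate_mset (\<beta> ! j) (is ! j)) = m}" (is "finite ?S")
proof (rule finite_subset)
  show "?S \<subseteq> {is. set is \<subseteq> set_mset m \<and> length is = length \<beta>}"
  proof safe
    fix "is" x
    assume l: "length is = length \<beta>" and "x \<in> set is"
    then obtain j where j: "j < length \<beta>" "x = is ! j" by (metis in_set_conv_nth)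
    then have "\<beta> ! j \<noteq> 0" using assms by (metis composition_def nth_mem)
    then show "x \<in># (\<Sum>j<length \<beta>. replicate_mset (\<beta> ! j) (is ! j))"
      using j by (auto simp: set_mset_sum)
  qed
qed (rule finite_lists_length_eq, simp)

lemma finite_skew_diagram: "finite (skew_diagram lam \<mu>)"
proof -
  have "diagram lam = Sigma {..<length lam} (\<lambda>i. {..<lam ! i})" by (auto simp: diagram_def)
  then show ?thesis by (simp add: skew_diagram_def)
qed

lemma finite_tableaux_with_content:
  "finite {T \<in> semistandard_tableaux (skew_diagram lam \<mu>).
     image_mset T (mset_set (skew_diagram lam \<mu>)) = m}" (is "finite ?S")
proof (rule finite_subset)
  show "?S \<subseteq> PiE (skew_diagram lam \<mu>) (\<lambda>_. set_mset m)"
    using finite_skew_diagram[of lam \<mu>] by (auto simp: semistandard_tableaux_def PiE_def)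
qed (auto intro: finite_PiE finite_skew_diagram)

end

theory Submission
  imports Defs
begin

text \<open>
  The coefficients \<open>c\<^bsup>\<lambda>\<^esup>\<^bsub>\<mu>,\<nu>\<^esub>\<close> are read off from \<open>s\<^bsub>\<lambda>/\<mu>\<^esub>\<close> alone, so it is enough that
  the two ribbon Schur functions agree, one monomial \<open>m\<close> at a time.

  Walk along a ribbon from its bottom left to its top right box: each step goes either to the
  right or up. Read along this walk, a semistandard tableau is a word in which steps to the right
  are weak ascents and steps up are strict descents. Hence the coefficient of \<open>m\<close> in the ribbon
  Schur function of \<open>\<beta>\<close> is the number \<open>r\<^sub>m(\<beta>)\<close> of rearrangements of \<open>m\<close> whose maximal weakly
  increasing runs have the lengths \<open>\<beta>\<^sub>1, \<beta>\<^sub>2, \<dots>\<close> (lemma \<open>skew_schur_ribbon\<close>).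

  The same numbers are the coefficients of a symmetric function in the basis of the \<open>F\<^sub>\<alpha>\<close>, namely
  of the product \<open>h\<^sub>m\<close> of the complete homogeneous functions whose degrees are the exponents of \<open>m\<close>:
  \<open>h\<^sub>m = \<Sum>\<^sub>\<alpha> r\<^sub>m(\<alpha>) F\<^sub>\<alpha>\<close>.
  Indeed a monomial \<open>k\<close> occurs in \<open>F\<^sub>\<alpha>\<close> with coefficient 1 if its exponents, in the order of the
  variables, refine \<open>\<alpha>\<close>, and with coefficient 0 otherwise. Its coefficient on the right hand side is
  therefore the number of rearrangements of \<open>m\<close> that are cut into weakly increasing pieces when
  they are cut into pieces whose lengths are the exponents of \<open>k\<close>. An increasing piece is determined
  by its multiset of letters, so these words amount to the ways of distributing \<open>m\<close> over the
  variables of \<open>k\<close>, and the number of distributions does not depend on the order of the variables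
  (lemma \<open>linear_comb_run_coefficient_symmetric\<close>). Now \<open>\<beta> \<sim> \<gamma>\<close>, applied to \<open>h\<^sub>m\<close>, says that
  \<open>r\<^sub>m(\<beta>) = r\<^sub>m(\<gamma>)\<close>.
\<close>


section \<open>Runs of a list\<close>

text \<open>
  Maximal blocks whose neighbouring entries are related by \<open>P\<close>. The relation is a parameter because
  the rows of a ribbon are runs as well: those of its boxes with respect to lying in the same row.
\<close>

fun runs :: "('a \<Rightarrow> 'a \<Rightarrow> bool) \<Rightarrow> 'a list \<Rightarrow> 'a list list" where
  "runs P [] = []"
| "runs P [x] = [[x]]"
| "runs P (x # y # zs) =
     (if P x y then (x # hd (runs P (y # zs))) # tl (runs P (y # zs)) else [x] # runs P (y # zs))"

lemma runs_eq_Nil_iff [simp]: "runs P xs = [] \<longleftrightarrow> xs = []"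
  by (induction P xs rule: runs.induct) auto

lemma Nil_notin_runs: "[] \<notin> set (runs P xs)"
  by (induction P xs rule: runs.induct) (auto dest: list.set_sel(2)[rotated])

lemma concat_runs [simp]: "concat (runs P xs) = xs"
proof (induction P xs rule: runs.induct)
  case (3 P x y zs)
  then show ?case by (cases "runs P (y # zs)") (auto split: if_splits)
qed auto

lemma hd_hd_runs: "xs \<noteq> [] \<Longrightarrow> hd (hd (runs P xs)) = hd xs"
  by (induction P xs rule: runs.induct) auto

lemma successively_runs: "r \<in> set (runs P xs) \<Longrightarrow> successively P r"
proof (induction P xs arbitrary: r rule: runs.induct)
  case (3 P x y zs)
  obtain u us where u: "runs P (y # zs) = u # us"
    by (cases "runs P (y # zs)") auto
  have "u \<noteq> []" using Nil_notin_runs[of P "y # zs"] u by auto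
  moreover have "hd u = y" using hd_hd_runs[of "y # zs" P] u by simp
  ultimately obtain u' where "u = y # u'" by (cases u) auto
  with 3 u show ?case by (auto split: if_splits)
qed auto

lemma sum_list_run_lengths: "sum_list (map length (runs P xs)) = length xs"
  by (metis concat_runs length_concat)

lemma runs_append:
  assumes "v \<noteq> []" and "successively P v"
  shows "runs P (v @ xs) =
    (if xs = [] then [v]
     else if P (last v) (hd xs) then (v @ hd (runs P xs)) # tl (runs P xs)
     else v # runs P xs)"
  using assms
proof (induction v)
  case (Cons x v)
  then show ?case
    by (cases v; cases xs) auto
qed simp

text \<open>
  The run lengths of a list record exactly at which positions the relation fails, so that lists over
  different types, with different relations, can be compared position by position.
\<close>

lemma run_lengths_eq_iff:
  assumes "length xs = length ys"
  shows "map length (runs P xs) = map length (runs Q ys) \<longleftrightarrow>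
    (\<forall>k. Suc k < length xs \<longrightarrow> P (xs ! k) (xs ! Suc k) = Q (ys ! k) (ys ! Suc k))"
  using assms
proof (induction P xs arbitrary: ys rule: runs.induct)
  case (2 P x)
  then obtain u where "ys = [u]" by (cases ys) auto
  then show ?case by simp
next
  case (3 P x y zs)
  then obtain u v ws where ys: "ys = u # v # ws" and "length (y # zs) = length (v # ws)"
    by (cases ys; cases "tl ys") auto
  obtain r rs where r: "runs P (y # zs) = r # rs"
    by (cases "runs P (y # zs)") auto
  obtain s ss where s: "runs Q (v # ws) = s # ss"
    by (cases "runs Q (v # ws)") auto
  have ne: "r \<noteq> []" "s \<noteq> []"
    using Nil_notin_runs[of P "y # zs"] Nil_notin_runs[of Q "v # ws"] r s by auto
  have IH: "map length (runs P (y # zs)) = map length (runs Q (v # ws)) \<longleftrightarrow>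
      (\<forall>k. Suc k < length (y # zs) \<longrightarrow> P ((y # zs) ! k) ((y # zs) ! Suc k) = Q ((v # ws) ! k) ((v # ws) ! Suc k))"
    using 3 \<open>length (y # zs) = length (v # ws)\<close> by blast
  have "map length (runs P (x # y # zs)) = map length (runs Q ys) \<longleftrightarrow>
      P x y = Q u v \<and> map length (runs P (y # zs)) = map length (runs Q (v # ws))"
    using ne r s ys by auto
  also have "\<dots> \<longleftrightarrow> (\<forall>k. Suc k < length (x # y # zs) \<longrightarrow>
      P ((x # y # zs) ! k) ((x # y # zs) ! Suc k) = Q (ys ! k) (ys ! Suc k))"
    unfolding IH ys by (simp add: All_less_Suc2)
  finally show ?case .
qed auto

text \<open>
  In a weakly decreasing list equal entries are neighbours, and each run consists of all copies of
  one number. Applied to the row indices of boxes this yields the row lengths from bottom to top.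
\<close>

lemma run_lengths_of_decreasing:
  assumes "sorted_wrt (\<ge>) xs" and "\<forall>x\<in>set xs. x < L"
  shows "map length (runs (=) xs) = rev (filter (\<lambda>k. k \<noteq> 0) (map (count_list xs) [0..<L]))"
  using assms
proof (induction L arbitrary: xs)
  case 0
  then show ?case by (cases xs) auto
next
  case (Suc L)
  define u v where "u = takeWhile (\<lambda>x. x = L) xs" and "v = dropWhile (\<lambda>x. x = L) xs"
  have xs: "xs = u @ v" by (simp add: u_def v_def)
  have u: "\<forall>x\<in>set u. x = L" by (auto simp: u_def dest: set_takeWhileD)
  have sv: "sorted_wrt (\<ge>) v" using Suc.prems xs by (simp add: sorted_wrt_append)
  have v: "\<forall>x\<in>set v. x < L"
  proof (cases v)
    case (Cons y ys)
    then have "y \<noteq> L" using hd_dropWhile[of "\<lambda>x. x = L" xs] by (auto simp: v_def)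
    then have "y < L" using Suc.prems xs Cons by auto
    then show ?thesis using sv Cons by auto
  qed simp
  have cL: "count_list u L = length u" using u by (induction u) auto
  have cu: "count_list u x = 0" if "x < L" for x using u that by (auto simp: count_list_0_iff)
  have cv: "count_list v L = 0" using v by (auto simp: count_list_0_iff)
  have "successively (=) u"
    unfolding successively_conv_nth using u by (metis Suc_lessD nth_mem)
  then have "map length (runs (=) xs) = (if u = [] then [] else [length u]) @ map length (runs (=) v)"
  proof (cases "u = [] \<or> v = []")
    case False
    then have "last u \<noteq> hd v" using u v by (metis last_in_set hd_in_set less_irrefl)
    then show ?thesis using False runs_append[OF _ \<open>successively (=) u\<close>, of v] xs by simp
  qed (use runs_append[OF _ \<open>successively (=) u\<close>, of v] xs in auto)
  also have "map length (runs (=) v) = rev (filter (\<lambda>k. k \<noteq> 0) (map (count_list v) [0..<L]))"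
    using Suc.IH sv v by blast
  also have "map (count_list v) [0..<L] = map (count_list xs) [0..<L]"
    using cu by (auto simp: xs)
  finally show ?case using cL cv by (simp add: xs[THEN arg_cong, of "\<lambda>xs. count_list xs L"])
qed


section \<open>Runs and refinements\<close>

lemma split_list_into_lengths:
  assumes "sum_list ls = length xs"
  shows "\<exists>xss. concat xss = xs \<and> map length xss = ls"
  using assms
proof (induction ls arbitrary: xs)
  case (Cons l ls)
  then obtain xss where "concat xss = drop l xs" "map length xss = ls"
    by (metis add_diff_cancel_left' length_drop sum_list.Cons)
  then show ?case using Cons.prems by (intro exI[of _ "take l xs # xss"]) auto
qed simp

text \<open>
  Cutting a run further leaves increasing pieces; conversely, a run is maximal, so increasing pieces
  never cross its ends and the pieces inside it can be grouped together.
\<close>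

lemma refines_run_lengths_iff:
  assumes "composition \<delta>"
  shows "refines \<delta> (map length (runs (\<le>) w)) \<longleftrightarrow>
    (\<exists>ws. concat ws = w \<and> map length ws = \<delta> \<and> (\<forall>u\<in>set ws. sorted u))"
    (is "?L \<longleftrightarrow> ?R")
proof
  have split: "\<exists>ws. concat ws = concat rs \<and> map length ws = concat bs \<and> (\<forall>u\<in>set ws. sorted u)"
    if "map sum_list bs = map length rs" "\<forall>u\<in>set rs. sorted u" for bs and rs :: "'a list list"
    using that
  proof (induction bs arbitrary: rs)
    case (Cons b bs)
    then obtain r rs' where rs: "rs = r # rs'" "sum_list b = length r"
        "map sum_list bs = map length rs'" "sorted r"
      by auto
    obtain us where us: "concat us = r" "map length us = b"
      using split_list_into_lengths rs(2) by blast
    obtain ws where ws: "concat ws = concat rs'" "map length ws = concat bs" "\<forall>u\<in>set ws. sorted u"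
      using Cons.IH rs Cons.prems by fastforce
    have "\<forall>u\<in>set us. sorted u"
      using rs(4) us(1) by (metis in_set_conv_decomp concat.simps(2) concat_append sorted_append)
    then show ?case using us ws rs by (intro exI[of _ "us @ ws"]) auto
  qed simp
  assume ?L
  then show ?R
    using split[of _ "runs (\<le>) w"] successively_runs[of _ "(\<le>)" w]
    by (auto simp: refines_def successively_conv_sorted_wrt)
next
  have group: "\<exists>wss. [] \<notin> set wss \<and> concat wss = ws \<and> map concat wss = runs (\<le>) (concat ws)"
    if "[] \<notin> set ws" "\<forall>u\<in>set ws. sorted u" for ws :: "'a list list"
    using that
  proof (induction ws)
    case (Cons v ws)
    then obtain wss where wss: "[] \<notin> set wss" "concat wss = ws" "map concat wss = runs (\<le>) (concat ws)"
      by auto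
    have v: "v \<noteq> []" "successively (\<le>) v" using Cons.prems by (auto simp: successively_conv_sorted_wrt)
    show ?case
    proof (cases "concat ws = [] \<or> \<not> last v \<le> hd (concat ws)")
      case True
      then show ?thesis using wss v runs_append[OF v, of "concat ws"]
        by (intro exI[of _ "[v] # wss"]) auto
    next
      case False
      then obtain ps pss where "wss = ps # pss" using wss by (cases wss) auto
      then show ?thesis using False wss v runs_append[OF v, of "concat ws"]
        by (intro exI[of _ "(v # ps) # pss"]) (auto simp: wss(3)[symmetric])
    qed
  qed simp
  assume ?R
  then obtain ws where ws: "concat ws = w" "map length ws = \<delta>" "\<forall>u\<in>set ws. sorted u"
    by blast
  then have "[] \<notin> set ws" using assms by (force simp: composition_def)
  then obtain wss where wss: "[] \<notin> set wss" "concat wss = ws" "map concat wss = runs (\<le>) w"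
    using group ws by blast
  have "map length (runs (\<le>) w) = map (sum_list \<circ> map length) wss"
    by (simp add: wss(3)[symmetric] length_concat)
  then show ?L
    unfolding refines_def using assms wss ws(2)
    by (intro conjI exI[of _ "map (map length) wss"]) (auto simp: map_concat)
qed


section \<open>Coefficients of fundamental quasisymmetric functions\<close>

text \<open>
  The only composition \<open>\<beta>\<close> for which the monomial occurs in \<open>M\<^sub>\<beta>\<close>.
\<close>

definition exponents :: "monomial \<Rightarrow> nat list" where
  "exponents k = map (count k) (sorted_list_of_set (set_mset k))"

lemma composition_exponents: "composition (exponents k)"
  by (auto simp: composition_def exponents_def) (metis count_eq_zero_iff)

text \<open>
  As \<open>\<beta>\<close> has no zero entries, the indices \<open>i\<^sub>1 < i\<^sub>2 < \<dots>\<close> must be the variables of \<open>k\<close> in increasing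
  order, and the entries of \<open>\<beta>\<close> are then forced to be their exponents.
\<close>

lemma monomial_qsym_eq:
  assumes "composition \<beta>"
  shows "monomial_qsym \<beta> k = (if \<beta> = exponents k then 1 else 0)"
proof -
  let ?s = "sorted_list_of_set (set_mset k)"
  have *: "length is = length \<beta> \<and> sorted_wrt (<) is \<and>
     (\<Sum>j<length \<beta>. replicate_mset (\<beta> ! j) (is ! j)) = k \<longleftrightarrow> \<beta> = exponents k \<and> is = ?s"
    (is "?L is \<longleftrightarrow> _") for "is"
  proof
    assume L: "?L is"
    then have d: "distinct is" using strict_sorted_iff by blast
    have "set_mset k = (\<Union>j<length \<beta>. set_mset (replicate_mset (\<beta> ! j) (is ! j)))"
      using L by (auto simp: set_mset_sum)
    also have "\<dots> = (\<Union>j<length \<beta>. {is ! j})"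
      using assms by (intro SUP_cong) (auto simp: composition_def in_set_conv_nth)
    also have "\<dots> = set is" using L by (auto simp: set_conv_nth)
    finally have s: "is = ?s"
      using L by (metis sorted_list_of_set.idem_if_sorted_distinct strict_sorted_iff)
    have "count k (is ! i) = \<beta> ! i" if "i < length \<beta>" for i
    proof -
      have "count k (is ! i) = (\<Sum>j<length \<beta>. if j = i then \<beta> ! j else 0)"
        using L that d by (auto simp: count_sum nth_eq_iff_index_eq intro!: sum.cong)
      then show ?thesis using that by simp
    qed
    then have "\<beta> = map (count k) is" using L by (auto intro!: nth_equalityI)
    with s show "\<beta> = exponents k \<and> is = ?s" by (simp add: exponents_def)
  next
    assume R: "\<beta> = exponents k \<and> is = ?s"
    have "(\<Sum>j<length \<beta>. replicate_mset (\<beta> ! j) (is ! j)) =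
        (\<Sum>j<length ?s. replicate_mset (count k (?s ! j)) (?s ! j))"
      using R by (auto simp: exponents_def intro!: sum.cong)
    also have "\<dots> = (\<Sum>i\<in>set_mset k. replicate_mset (count k i) i)"
      by (rule sum.reindex_bij_betw) (auto intro!: bij_betw_nth)
    also have "\<dots> = k"
      by (rule multiset_eqI) (simp add: count_sum count_eq_zero_iff)
    finally show "?L is" using R by (auto simp: exponents_def)
  qed
  have "{is. ?L is} = (if \<beta> = exponents k then {?s} else {})"
    unfolding * by auto
  then show ?thesis unfolding monomial_qsym_def by (simp only:) auto
qed

lemma fundamental_qsym_eq:
  "fundamental_qsym \<alpha> k = (if refines (exponents k) \<alpha> then 1 else 0)"
proof -
  have "fundamental_qsym \<alpha> k = (\<Sum>\<gamma> | refines \<gamma> \<alpha>. if \<gamma> = exponents k then 1 else 0)"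
    unfolding fundamental_qsym_def by (auto intro!: sum.cong simp: monomial_qsym_eq refines_def)
  then show ?thesis using finite_refinements[of \<alpha>] by simp
qed


section \<open>The complete homogeneous symmetric functions\<close>

text \<open>
  The coefficient of \<open>F\<^sub>\<alpha>\<close> in \<open>h\<^sub>m\<close>, and also that of \<open>m\<close> in the skew Schur function of a ribbon
  whose rows have the lengths \<open>\<alpha>\<close> from bottom to top.
\<close>

definition run_coefficient :: "monomial \<Rightarrow> nat list \<Rightarrow> rat" where
  "run_coefficient m \<alpha> = of_nat (card {w. mset w = m \<and> map length (runs (\<le>) w) = \<alpha>})"

text \<open>
  These are the nonnegative integer matrices with row sums \<open>count m\<close> and column sums \<open>count k\<close>, given
  by their columns; they are counted by the coefficient of \<open>k\<close> in \<open>h\<^sub>m\<close>. A column outside the variables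
  of \<open>k\<close> has size 0, so a function is determined by the columns that belong to variables of \<open>k\<close>.
\<close>

definition distributions :: "monomial \<Rightarrow> monomial \<Rightarrow> (nat \<Rightarrow> monomial) set" where
  "distributions m k = {A. (\<forall>i. size (A i) = count k i) \<and> (\<Sum>i\<in>set_mset k. A i) = m}"

lemma finite_words: "finite {w. mset w = m}"
proof (rule finite_subset)
  show "{w. mset w = m} \<subseteq> {w. set w \<subseteq> set_mset m \<and> length w = size m}" by auto
qed (rule finite_lists_length_eq, simp)

lemma finite_run_coefficient_support: "finite {\<alpha>. run_coefficient m \<alpha> \<noteq> 0}"
proof (rule finite_subset)
  show "{\<alpha>. run_coefficient m \<alpha> \<noteq> 0} \<subseteq> (\<lambda>w. map length (runs (\<le>) w)) ` {w. mset w = m}"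
    by (auto simp: run_coefficient_def card_eq_0_iff)
qed (simp add: finite_words)

lemma composition_run_lengths: "composition (map length (runs P w))"
  using Nil_notin_runs[of P w] by (auto simp: composition_def)

lemma composition_run_coefficient_support: "run_coefficient m \<alpha> \<noteq> 0 \<Longrightarrow> composition \<alpha>"
  by (auto simp: run_coefficient_def card_eq_0_iff composition_run_lengths)

lemma linear_comb_run_coefficient:
  "linear_comb (run_coefficient m) fundamental_qsym k =
     of_nat (card {w. mset w = m \<and> refines (exponents k) (map length (runs (\<le>) w))})"
proof -
  let ?S = "{\<alpha>. run_coefficient m \<alpha> \<noteq> 0}"
  let ?W = "{w. mset w = m \<and> refines (exponents k) (map length (runs (\<le>) w))}"
  have fW: "finite ?W" using finite_words[of m] by (rule rev_finite_subset) auto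
  have "linear_comb (run_coefficient m) fundamental_qsym k =
      (\<Sum>\<alpha>\<in>?S. of_nat (card {w\<in>?W. map length (runs (\<le>) w) = \<alpha>}))"
    unfolding linear_comb_def
  proof (intro sum.cong refl)
    fix \<alpha>
    have "{w\<in>?W. map length (runs (\<le>) w) = \<alpha>} =
        (if refines (exponents k) \<alpha> then {w. mset w = m \<and> map length (runs (\<le>) w) = \<alpha>} else {})"
      by auto
    then show "run_coefficient m \<alpha> * fundamental_qsym \<alpha> k =
        of_nat (card {w\<in>?W. map length (runs (\<le>) w) = \<alpha>})"
      by (simp add: fundamental_qsym_eq run_coefficient_def)
  qed
  also have "\<dots> = of_nat (\<Sum>\<alpha>\<in>?S. card {w\<in>?W. map length (runs (\<le>) w) = \<alpha>})" by simp
  also have "(\<Sum>\<alpha>\<in>?S. card {w\<in>?W. map length (runs (\<le>) w) = \<alpha>}) =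
      card (\<Union>\<alpha>\<in>?S. {w\<in>?W. map length (runs (\<le>) w) = \<alpha>})"
  proof (intro card_UN_disjoint[symmetric] ballI impI)
    show "finite ?S" by (rule finite_run_coefficient_support)
    show "finite {w\<in>?W. map length (runs (\<le>) w) = \<alpha>}" for \<alpha>
      by (rule finite_subset[OF _ fW]) blast
  qed blast
  also have "(\<Union>\<alpha>\<in>?S. {w\<in>?W. map length (runs (\<le>) w) = \<alpha>}) = ?W"
    using finite_words[of m] by (auto simp: run_coefficient_def card_eq_0_iff)
  finally show ?thesis .
qed

text \<open>
  A distribution becomes a word by writing each part in increasing order and concatenating the parts
  in the order of the variables. The word can be cut again, since the lengths are known.
\<close>

lemma card_words_eq_card_distributions:
  "card {w. mset w = m \<and> refines (exponents k) (map length (runs (\<le>) w))} = card (distributions m k)"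
proof -
  let ?s = "sorted_list_of_set (set_mset k)"
  let ?ws = "\<lambda>A. map (\<lambda>i. sorted_list_of_multiset (A i)) ?s"
  let ?W = "{w. mset w = m \<and> refines (exponents k) (map length (runs (\<le>) w))}"
  have lens: "map length (?ws A) = exponents k" if "A \<in> distributions m k" for A
    using that by (auto simp: exponents_def distributions_def simp flip: size_mset)
  have "inj_on (\<lambda>A. concat (?ws A)) (distributions m k)"
  proof (rule inj_onI)
    fix A B assume AB: "A \<in> distributions m k" "B \<in> distributions m k" "concat (?ws A) = concat (?ws B)"
    then have "map length (?ws A) = map length (?ws B)" using lens by simp
    then have "?ws A = ?ws B"
      using AB(3) by (intro concat_injective) (auto simp: zip_map_map zip_same_conv_map)
    then have "\<forall>i\<in>#k. sorted_list_of_multiset (A i) = sorted_list_of_multiset (B i)" by simp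
    then have "A i = B i" if "i \<in># k" for i using that by (metis mset_sorted_list_of_multiset)
    moreover have "A i = B i" if "i \<notin># k" for i
      using that AB(1,2) by (simp add: distributions_def not_in_iff) (metis size_eq_0_iff_empty)
    ultimately show "A = B" by blast
  qed
  moreover have "(\<lambda>A. concat (?ws A)) ` distributions m k = ?W"
  proof (intro equalityI subsetI)
    fix w assume "w \<in> (\<lambda>A. concat (?ws A)) ` distributions m k"
    then obtain A where A: "A \<in> distributions m k" and w: "w = concat (?ws A)" by auto
    have "mset w = (\<Sum>i\<leftarrow>?s. A i)" by (simp add: w mset_concat o_def)
    also have "\<dots> = m" using A by (simp add: sum_list_distinct_conv_sum_set distributions_def)
    finally show "w \<in> ?W"
      using lens[OF A] w by (auto simp: refines_run_lengths_iff[OF composition_exponents])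
  next
    fix w assume "w \<in> ?W"
    then obtain ws where m: "mset w = m" and ws: "concat ws = w" "map length ws = exponents k" "\<forall>u\<in>set ws. sorted u"
      by (auto simp: refines_run_lengths_iff[OF composition_exponents])
    have l: "length ws = length ?s" using ws(2) by (metis length_map exponents_def)
    define A where "A i = (case map_of (zip ?s ws) i of None \<Rightarrow> {#} | Some u \<Rightarrow> mset u)" for i
    have A: "A (?s ! j) = mset (ws ! j)" if "j < length ?s" for j
      unfolding A_def using that l by (subst map_of_zip_nth) auto
    have A0: "A i = {#}" if "i \<notin># k" for i
    proof -
      have "map_of (zip ?s ws) i = None" using that l by (simp add: map_of_zip_is_None)
      then show ?thesis by (simp add: A_def)
    qed
    have eq: "map A ?s = map mset ws" using A l by (auto intro!: nth_equalityI)
    have "?ws A = map sorted_list_of_multiset (map A ?s)" by simp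
    also have "\<dots> = ws" unfolding eq using ws(3) by (auto intro!: map_idI simp: sorted_sort_id)
    finally have "?ws A = ws" .
    moreover have "A \<in> distributions m k"
    proof -
      have "map size (map A ?s) = map (count k) ?s"
        unfolding eq using ws(2) by (simp add: exponents_def o_def)
      then have "\<forall>i\<in>#k. size (A i) = count k i" by simp
      then have "\<forall>i. size (A i) = count k i" using A0 by (metis not_in_iff size_empty)
      moreover have "(\<Sum>i\<in>set_mset k. A i) = sum_list (map A ?s)"
        by (simp add: sum_list_distinct_conv_sum_set)
      then have "(\<Sum>i\<in>set_mset k. A i) = m"
        unfolding eq using m ws(1) by (auto simp: mset_concat)
      ultimately show ?thesis by (simp add: distributions_def)
    qed
    ultimately show "w \<in> (\<lambda>A. concat (?ws A)) ` distributions m k" using ws(1) by force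
  qed
  ultimately show ?thesis using card_image by metis
qed

lemma card_distributions_image_mset:
  assumes "bij \<pi>"
  shows "card (distributions m (image_mset \<pi> k)) = card (distributions m k)"
proof (rule sym, rule bij_betw_same_card)
  have inj: "inj \<pi>" and surj: "surj \<pi>" using assms by (auto simp: bij_def)
  have count: "count (image_mset \<pi> k) (\<pi> i) = count k i" for i
    using inj by (induction k) (auto simp: inj_eq)
  show "bij_betw (\<lambda>A. A \<circ> inv \<pi>) (distributions m k) (distributions m (image_mset \<pi> k))"
  proof (rule bij_betw_byWitness[where f' = "\<lambda>A. A \<circ> \<pi>"])
    show "(\<lambda>A. A \<circ> inv \<pi>) ` distributions m k \<subseteq> distributions m (image_mset \<pi> k)"
    proof safe
      fix A assume A: "A \<in> distributions m k"
      have "size (A (inv \<pi> i)) = count (image_mset \<pi> k) i" for i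
        using A count[of "inv \<pi> i"] surj by (simp add: distributions_def surj_f_inv_f)
      then show "A \<circ> inv \<pi> \<in> distributions m (image_mset \<pi> k)"
        using A inj by (simp add: distributions_def sum.reindex inj_on_subset[OF inj])
    qed
    show "(\<lambda>A. A \<circ> \<pi>) ` distributions m (image_mset \<pi> k) \<subseteq> distributions m k"
      using inj by (auto simp: distributions_def sum.reindex inj_on_subset[OF inj] count)
  qed (use inj surj in \<open>auto simp: fun_eq_iff surj_f_inv_f\<close>)
qed

text \<open>
  This series is \<open>h\<^sub>m\<close>: its coefficients count distributions, which a permutation of the variables
  merely relabels.
\<close>

lemma linear_comb_run_coefficient_symmetric:
  "linear_comb (run_coefficient m) fundamental_qsym \<in> symmetric_functions"
proof -
  have eq: "linear_comb (run_coefficient m) fundamental_qsym k = of_nat (card (distributions m k))" for k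
    by (simp add: linear_comb_run_coefficient card_words_eq_card_distributions)
  have "size k \<le> size m" if nonzero: "card (distributions m k) \<noteq> 0" for k
  proof -
    obtain A where A: "A \<in> distributions m k" using nonzero by (cases "distributions m k = {}") auto
    have "size m = (\<Sum>i\<in>set_mset k. size (A i))"
      using A by (auto simp: distributions_def)
    also have "\<dots> = size k" using A by (simp add: distributions_def size_multiset_overloaded_eq)
    finally show ?thesis by simp
  qed
  then show ?thesis
    unfolding symmetric_functions_def by (auto simp: eq card_distributions_image_mset)
qed



section \<open>Ribbons\<close>

text \<open>
  Boxes of equal content form a diagonal that descends to the right.
\<close>

definition box_content :: "nat \<times> nat \<Rightarrow> int" where
  "box_content p = int (snd p) - int (fst p)"

lemma diagram_downward_closed:
  assumes "is_partition \<nu>" "(c, d) \<in> diagram \<nu>" "i \<le> c" "j \<le> d"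
  shows "(i, j) \<in> diagram \<nu>"
proof -
  have "\<nu> ! c \<le> \<nu> ! i"
    using assms by (cases "i = c") (auto simp: is_partition_def diagram_def sorted_wrt_iff_nth_less)
  then show ?thesis using assms by (auto simp: diagram_def)
qed

lemma skew_diagram_convex:
  assumes "skew_shape lam \<mu>" "(a, b) \<in> skew_diagram lam \<mu>" "(c, d) \<in> skew_diagram lam \<mu>"
    and "a \<le> i" "i \<le> c" "b \<le> j" "j \<le> d"
  shows "(i, j) \<in> skew_diagram lam \<mu>"
  using assms diagram_downward_closed[of lam c d i j] diagram_downward_closed[of \<mu> i j a b]
  by (auto simp: skew_shape_def skew_diagram_def)

text \<open>
  Two boxes on one diagonal would, by convexity, enclose a \<open>2 \<times> 2\<close> array.
\<close>

lemma inj_on_box_content: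
  assumes "ribbon lam \<mu>"
  shows "inj_on box_content (skew_diagram lam \<mu>)"
proof -
  let ?D = "skew_diagram lam \<mu>"
  have no_diagonal: False if "(i, j) \<in> ?D" "(i', j') \<in> ?D" "i < i'" "j < j'" for i j i' j'
  proof -
    have "skew_shape lam \<mu>" using assms by (simp add: ribbon_def)
    then have "{(i, j), (i, Suc j), (Suc i, j), (Suc i, Suc j)} \<subseteq> ?D"
      using that by (auto intro: skew_diagram_convex[of lam \<mu> i j i' j'])
    then show False using assms by (auto simp: ribbon_def)
  qed
  show ?thesis
    unfolding inj_on_def
  proof safe
    fix i j i' j'
    assume D: "(i, j) \<in> ?D" "(i', j') \<in> ?D" and eq: "box_content (i, j) = box_content (i', j')"
    have "i = i'"
    proof (rule ccontr)
      assume "i \<noteq> i'"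
      with eq have "i < i' \<and> j < j' \<or> i' < i \<and> j' < j" by (auto simp: box_content_def)
      then show False using D no_diagonal by blast
    qed
    then show "i = i'" "j = j'" using eq by (auto simp: box_content_def)
  qed
qed

lemma adjacent_box_content:
  "adjacent p q \<Longrightarrow> \<bar>box_content q - box_content p\<bar> = 1"
  by (cases p; cases q) (auto simp: box_content_def)

text \<open>
  A path between boxes on both sides of a diagonal has to cross it at some step.
\<close>

lemma connected_diagram_crossing:
  assumes "connected_diagram D" "p \<in> D" "q \<in> D" "box_content p \<le> x" "x < box_content q"
  obtains p' q' where "p' \<in> D" "q' \<in> D" "adjacent p' q'" "box_content p' \<le> x" "x < box_content q'"
proof -
  have "(p, q) \<in> {(a, b). a \<in> D \<and> b \<in> D \<and> adjacent a b}\<^sup>*"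
    using assms by (simp add: connected_diagram_def)
  then have "\<exists>p' q'. p' \<in> D \<and> q' \<in> D \<and> adjacent p' q' \<and> box_content p' \<le> x \<and> x < box_content q'"
    using assms(5)
  proof (induction rule: rtrancl_induct)
    case base
    then show ?case using assms(4) by simp
  next
    case (step y z)
    show ?case
    proof (cases "x < box_content y")
      case True
      then show ?thesis by (rule step.IH)
    next
      case False
      then show ?thesis using step.hyps(2) step.prems by (intro exI[of _ y] exI[of _ z]) simp
    qed
  qed
  then show thesis using that by blast
qed

text \<open>
  The list \<open>bs\<close> is the walk along the ribbon from bottom left to top right. The content grows by one
  with a step to the right as well as with a step up, so the walk is ordered by content.
\<close>

locale ribbon_boxes =
  fixes lam \<mu> :: "nat list" and bs :: "(nat \<times> nat) list"
  assumes ribbon: "ribbon lam \<mu>"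
    and set_bs: "set bs = skew_diagram lam \<mu>"
    and sorted_bs: "sorted_wrt (\<lambda>p q. box_content p < box_content q) bs"
    and step_bs: "\<And>k. Suc k < length bs \<Longrightarrow>
      adjacent (bs ! k) (bs ! Suc k) \<and> box_content (bs ! Suc k) = box_content (bs ! k) + 1"

text \<open>
  Sort the boxes by content. The path in the diagram that connects the boxes up to the \<open>k\<close>-th with
  the later ones must leave them by a step that raises the content by 1, and as contents are distinct this step can
  only lead from the \<open>k\<close>-th box to the next one.
\<close>

lemma ribbon_box_list:
  assumes "ribbon lam \<mu>"
  obtains bs where "ribbon_boxes lam \<mu> bs"
proof -
  let ?D = "skew_diagram lam \<mu>"
  define C where "C = box_content ` ?D"
  define g where "g = the_inv_into ?D box_content"
  define bs where "bs = map g (sorted_list_of_set C)"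
  note inj = inj_on_box_content[OF assms]
  have finC: "finite C" by (simp add: C_def finite_skew_diagram)
  have gC: "g ` C = ?D" unfolding g_def C_def using the_inv_into_onto[OF inj] .
  have content_g: "box_content (g x) = x" if "x \<in> C" for x
    using that f_the_inv_into_f[OF inj] by (simp add: g_def C_def)
  have contents: "map box_content bs = sorted_list_of_set C"
    using content_g finC by (auto simp: bs_def intro!: map_idI)
  have set: "set bs = ?D" using gC finC by (simp add: bs_def)
  have sorted: "sorted_wrt (\<lambda>p q. box_content p < box_content q) bs"
    using strict_sorted_list_of_set[of C] unfolding contents[symmetric] by (simp add: sorted_wrt_map)
  have less: "box_content (bs ! k) < box_content (bs ! l)" if "k < l" "l < length bs" for k l
    using sorted that by (simp add: sorted_wrt_iff_nth_less)
  have "adjacent (bs ! k) (bs ! Suc k) \<and> box_content (bs ! Suc k) = box_content (bs ! k) + 1"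
    if k: "Suc k < length bs" for k
  proof -
    have D: "bs ! k \<in> ?D" "bs ! Suc k \<in> ?D" using set k by (metis Suc_lessD nth_mem)+
    have "connected_diagram ?D" using assms by (simp add: ribbon_def)
    then obtain p q where pq: "p \<in> ?D" "q \<in> ?D" "adjacent p q"
      "box_content p \<le> box_content (bs ! k)" "box_content (bs ! k) < box_content q"
      using D less[OF lessI k] by (rule connected_diagram_crossing[OF _ _ _ order_refl])
    obtain l where l: "l < length bs" "p = bs ! l" using pq(1) set by (metis in_set_conv_nth)
    obtain l' where l': "l' < length bs" "q = bs ! l'" using pq(2) set by (metis in_set_conv_nth)
    have "k < l'" using less[of l' k] pq(5) k l' by (metis Suc_lessD less_asym not_less_iff_gr_or_eq)
    have abs: "\<bar>box_content q - box_content p\<bar> = 1" using adjacent_box_content[OF pq(3)] .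
    have p: "p = bs ! k"
    proof (rule ccontr)
      assume "p \<noteq> bs ! k"
      then have "box_content p \<noteq> box_content (bs ! k)"
        using inj_onD[OF inj _ pq(1) D(1)] by blast
      then show False using abs pq(4,5) by linarith
    qed
    have "l' = Suc k"
    proof (rule ccontr)
      assume "l' \<noteq> Suc k"
      then have "Suc k < l'" using \<open>k < l'\<close> by simp
      then show False using less[of "Suc k" l'] less[OF _ k, of k] l' abs p by simp
    qed
    then show ?thesis using p l' abs pq by simp
  qed
  with assms set sorted show thesis by (intro that ribbon_boxes.intro)
qed

context ribbon_boxes
begin

lemma distinct_bs: "distinct bs"
  using sorted_bs by (simp add: distinct_conv_nth sorted_wrt_iff_nth_less) (metis less_irrefl linorder_neqE_nat)

lemma step_cases:
  assumes "Suc k < length bs"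
  obtains (right) i j where "bs ! k = (i, j)" "bs ! Suc k = (i, Suc j)"
  | (up) i j where "bs ! k = (Suc i, j)" "bs ! Suc k = (i, j)"
  using step_bs[OF assms]
  by (cases "bs ! k"; cases "bs ! Suc k") (auto simp: box_content_def)

text \<open>
  No integer lies strictly between the two contents, so the walk has no box between \<open>p\<close> and \<open>q\<close>. Hence
  conditions on neighbouring boxes of a tableau become conditions on consecutive letters of a word.
\<close>

lemma consecutive:
  assumes "p \<in> skew_diagram lam \<mu>" "q \<in> skew_diagram lam \<mu>" "box_content q = box_content p + 1"
  obtains k where "Suc k < length bs" "p = bs ! k" "q = bs ! Suc k"
proof -
  have less: "box_content (bs ! k) < box_content (bs ! l)" if "k < l" "l < length bs" for k l
    using sorted_bs that by (simp add: sorted_wrt_iff_nth_less)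
  obtain k where k: "k < length bs" "p = bs ! k" using assms(1) set_bs by (metis in_set_conv_nth)
  obtain l where l: "l < length bs" "q = bs ! l" using assms(2) set_bs by (metis in_set_conv_nth)
  have "k < l" using less[of l k] assms(3) k l by (cases k l rule: linorder_cases) auto
  moreover have "\<not> Suc k < l" using less[of k "Suc k"] less[of "Suc k" l] assms(3) k l by auto
  ultimately have "l = Suc k" by simp
  then show thesis using that k l by blast
qed

text \<open>
  By convexity two boxes of a row or a column are joined by boxes between them, so semistandardness
  is a condition on neighbours. It is stated as an equality of truth values at each step because
  this is the form in which run lengths are compared.
\<close>

lemma tableau_iff:
  assumes "T \<in> extensional (skew_diagram lam \<mu>)"
  shows "T \<in> semistandard_tableaux (skew_diagram lam \<mu>) \<longleftrightarrow>
    (\<forall>k. Suc k < length bs \<longrightarrow>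
      (T (bs ! k) \<le> T (bs ! Suc k)) = (fst (bs ! k) = fst (bs ! Suc k)))"
    (is "_ \<longleftrightarrow> ?R")
proof
  let ?D = "skew_diagram lam \<mu>"
  assume T: "T \<in> semistandard_tableaux ?D"
  show ?R
  proof (intro allI impI)
    fix k assume k: "Suc k < length bs"
    have D: "bs ! k \<in> ?D" "bs ! Suc k \<in> ?D" using set_bs k by (metis Suc_lessD nth_mem)+
    show "(T (bs ! k) \<le> T (bs ! Suc k)) = (fst (bs ! k) = fst (bs ! Suc k))"
      using k
    proof (cases rule: step_cases)
      case (right i j)
      then show ?thesis using T D by (simp add: semistandard_tableaux_def)
    next
      case (up i j)
      then have "T (i, j) < T (Suc i, j)" using T D by (simp add: semistandard_tableaux_def)
      then show ?thesis using up by simp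
    qed
  qed
next
  let ?D = "skew_diagram lam \<mu>"
  assume R: ?R
  have conv: "(i, j) \<in> ?D" if "(a, b) \<in> ?D" "(c, d) \<in> ?D" "a \<le> i" "i \<le> c" "b \<le> j" "j \<le> d" for a b c d i j
    using skew_diagram_convex ribbon that unfolding ribbon_def by blast
  have "T (i, j) \<le> T (i, j')" if "(i, j) \<in> ?D" "(i, j') \<in> ?D" "j \<le> j'" for i j j'
    using \<open>j \<le> j'\<close> that(2)
  proof (induction j' rule: dec_induct)
    case (step l)
    then have D: "(i, l) \<in> ?D" "(i, Suc l) \<in> ?D" using conv[OF that(1), of i "Suc l" i l] by auto
    then obtain k where "Suc k < length bs" "(i, l) = bs ! k" "(i, Suc l) = bs ! Suc k"
      using consecutive[of "(i, l)" "(i, Suc l)"] by (auto simp: box_content_def)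
    then have "T (i, l) \<le> T (i, Suc l)" using R by (metis fst_conv)
    then show ?case using step D by simp
  qed simp
  moreover have "T (i, j) < T (i', j)" if "(i, j) \<in> ?D" "(i', j) \<in> ?D" "i < i'" for i i' j
  proof -
    have vertical: "T (l, j) < T (Suc l, j)" if D: "(l, j) \<in> ?D" "(Suc l, j) \<in> ?D" for l
    proof -
      obtain k where "Suc k < length bs" "(Suc l, j) = bs ! k" "(l, j) = bs ! Suc k"
        using consecutive[OF D(2,1)] by (auto simp: box_content_def)
      then show ?thesis using R by (metis fst_conv n_not_Suc_n not_le)
    qed
    have "Suc i \<le> i'" using \<open>i < i'\<close> by simp
    then show ?thesis using that(2)
    proof (induction i' rule: dec_induct)
      case base
      then show ?case using vertical that(1) by blast
    next
      case (step l)
      then have "(l, j) \<in> ?D" using conv[OF that(1), of "Suc l" j l j] by auto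
      then show ?case using step.IH step.prems vertical[of l] by force
    qed
  qed
  ultimately show "T \<in> semistandard_tableaux ?D"
    using assms by (simp add: semistandard_tableaux_def)
qed

text \<open>
  Steps never lead down, so the row indices along the walk decrease weakly.
\<close>

lemma run_lengths_rows:
  "map length (runs (\<lambda>p q. fst p = fst q) bs) = row_composition lam \<mu>"
proof -
  have "successively (\<ge>) (map fst bs)"
    unfolding successively_conv_nth
    by (auto elim: step_cases)
  then have "sorted_wrt (\<ge>) (map fst bs)"
    by (simp add: successively_conv_sorted_wrt transp_on_ge)
  moreover have "\<forall>i\<in>set (map fst bs). i < length lam"
    by (auto simp: set_bs skew_diagram_def diagram_def)
  moreover have "count_list (map fst bs) = (\<lambda>i. card {j. (i, j) \<in> skew_diagram lam \<mu>})"
  proof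
    fix i
    have "count_list (map fst bs) i = length (filter (\<lambda>p. fst p = i) bs)"
      by (simp add: count_list_eq_length_filter filter_map o_def eq_commute)
    also have "\<dots> = card {p \<in> skew_diagram lam \<mu>. fst p = i}"
      using distinct_bs set_bs by (metis distinct_card distinct_filter set_filter)
    also have "{p \<in> skew_diagram lam \<mu>. fst p = i} = Pair i ` {j. (i, j) \<in> skew_diagram lam \<mu>}"
      by auto
    also have "card \<dots> = card {j. (i, j) \<in> skew_diagram lam \<mu>}"
      by (simp add: card_image inj_on_def)
    finally show "count_list (map fst bs) i = card {j. (i, j) \<in> skew_diagram lam \<mu>}" .
  qed
  ultimately have "map length (runs (=) (map fst bs)) = row_composition lam \<mu>"
    using run_lengths_of_decreasing[of "map fst bs" "length lam"] by (simp add: row_composition_def)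
  moreover have "map length (runs (\<lambda>p q. fst p = fst q) bs) = map length (runs (=) (map fst bs))"
    by (simp add: run_lengths_eq_iff)
  ultimately show ?thesis by simp
qed

lemma skew_schur_eq: "skew_schur lam \<mu> m = run_coefficient m (row_composition lam \<mu>)"
proof -
  let ?D = "skew_diagram lam \<mu>"
  let ?S = "{T \<in> semistandard_tableaux ?D. image_mset T (mset_set ?D) = m}"
  let ?W = "{w. mset w = m \<and> map length (runs (\<le>) w) = row_composition lam \<mu>}"
  have mset: "mset (map T bs) = image_mset T (mset_set ?D)" for T :: "nat \<times> nat \<Rightarrow> nat"
    using distinct_bs set_bs by (metis mset_map mset_set_set)
  have tab: "T \<in> semistandard_tableaux ?D \<longleftrightarrow> map length (runs (\<le>) (map T bs)) = row_composition lam \<mu>"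
    if "T \<in> extensional ?D" for T
    unfolding tableau_iff[OF that] run_lengths_rows[symmetric]
    by (subst run_lengths_eq_iff) auto
  have ext: "T \<in> extensional ?D" if "T \<in> ?S" for T
    using that by (simp add: semistandard_tableaux_def)
  have "inj_on (\<lambda>T. map T bs) ?S"
  proof (rule inj_onI)
    fix T U assume TU: "T \<in> ?S" "U \<in> ?S" "map T bs = map U bs"
    show "T = U" by (rule extensionalityI[OF ext[OF TU(1)] ext[OF TU(2)]]) (use TU(3) set_bs in auto)
  qed
  moreover have "(\<lambda>T. map T bs) ` ?S = ?W"
  proof (intro equalityI subsetI)
    fix w assume "w \<in> (\<lambda>T. map T bs) ` ?S"
    then obtain T where T: "T \<in> ?S" and w: "w = map T bs" by blast
    show "w \<in> ?W" using T tab[OF ext[OF T]] mset[of T] by (simp add: w)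
  next
    fix w assume w: "w \<in> ?W"
    have "length w = sum_list (row_composition lam \<mu>)"
      using w sum_list_run_lengths by (metis (mono_tags) mem_Collect_eq)
    also have "\<dots> = length bs" using run_lengths_rows sum_list_run_lengths by metis
    finally have len: "length w = length bs" .
    define T where "T = restrict (\<lambda>p. the (map_of (zip bs w) p)) ?D"
    have "T (bs ! j) = w ! j" if "j < length bs" for j
      using that len distinct_bs set_bs by (auto simp: T_def map_of_zip_nth)
    then have map: "map T bs = w" using len by (auto intro!: nth_equalityI)
    have "T \<in> extensional ?D" by (simp add: T_def)
    then have "T \<in> ?S" using w tab mset[of T] map by simp
    with map show "w \<in> (\<lambda>T. map T bs) ` ?S" by blast
  qed
  ultimately have "card ?S = card ?W" using card_image[of "\<lambda>T. map T bs" ?S] by simp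
  then show ?thesis by (simp add: skew_schur_def run_coefficient_def)
qed

end

lemma skew_schur_ribbon:
  assumes "ribbon lam \<mu>"
  shows "skew_schur lam \<mu> m = run_coefficient m (row_composition lam \<mu>)"
proof -
  obtain bs where "ribbon_boxes lam \<mu> bs"
    using ribbon_box_list[OF assms] .
  then show ?thesis by (rule ribbon_boxes.skew_schur_eq)
qed

theorem corollary2p7:
  fixes lam \<mu> \<rho> \<eta> \<beta> \<gamma> :: "nat list" and n :: nat
  assumes "ribbon lam \<mu>" and "row_composition lam \<mu> = \<beta>"
    and "ribbon \<rho> \<eta>" and "row_composition \<rho> \<eta> = \<gamma>"
    and "composition_of n \<beta>" and "composition_of n \<gamma>"
    and "comp_equiv \<beta> \<gamma>"
  shows "\<forall>\<nu>. partition_of n \<nu> \<longrightarrow>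
           littlewood_richardson lam \<mu> \<nu> = littlewood_richardson \<rho> \<eta> \<nu>"
proof -
  have "run_coefficient m \<beta> = run_coefficient m \<gamma>" for m
    using assms(7) finite_run_coefficient_support[of m] composition_run_coefficient_support[of m]
      linear_comb_run_coefficient_symmetric[of m]
    by (simp add: comp_equiv_def)
  then have "skew_schur lam \<mu> = skew_schur \<rho> \<eta>"
    using assms(1-4) by (simp add: skew_schur_ribbon fun_eq_iff)
  then show ?thesis by (simp add: littlewood_richardson_def)
qed

end
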